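(* Let $P$ and $Q$ be probability distributions on a measurable space $(\mathcal{X},\mathcal{F})$ with $D(P\|Q)<\infty$. Then the following minimax identity holds: $$\sup_{\alpha\in(0,\infty)}\inf_R\big\{\alpha D(R\|P)+(1-\alpha)D(R\|Q)\big\}=\inf_R\sup_{\alpha\in(0,\infty)}\big\{\alpha D(R\|P)+(1-\alpha)D(R\|Q)\big\},$$ where $R$ ranges over all probability distributions on $(\mathcal{X},\mathcal{F})$, with the convention that $\alpha D(R\|P)+(1-\alpha)D(R\|Q)=\infty$ if it would otherwise be undefined. Moreover, the identity still holds if $\alpha$ is restricted to $(0,1)$ on its left-hand side; and if there exists an $\alpha^*\in(0,1)$ such that $D(P_{\alpha^*}\|P)=D(P_{\alpha^*}\|Q)$, then $(\alpha^*,P_{\alpha^*})$ is a saddle-point for the identity, i.e. with $f(\alpha,R)=\alpha D(R\|P)+(1-\alpha)D(R\|Q)$ one has $f(\alpha,P_{\alpha^*})\le f(\alpha^*,P_{\alpha^*})\le f(\alpha^*,R)$ for all $\alpha\in(0,\infty)$ and all $R$, and both sides of the identity are equal to $$(1-\alpha^* )D_{\alpha^*}(P\|Q)=\sup_{\alpha\in(0,1)}(1-\alpha)D_\alpha(P\|Q)=D(P_{\alpha^*}\|P)=D(P_{\alpha^*}\|Q).$$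
   Context: $\mu$ is a $\sigma$-finite measure dominating $P$ and $Q$ (its choice is immaterial), and $p,q$ are the densities of $P,Q$ with respect to $\mu$. Kullback-Leibler divergence: $D(P\|Q)=\int p\ln\frac{p}{q}\,d\mu\in[0,\infty]$, with the conventions $0\ln(0/q)=0$ and $p\ln(p/0)=\infty$ if $p>0$. Rényi divergence for $\alpha\in(0,1)$: $D_\alpha(P\|Q)=\frac{1}{\alpha-1}\ln\int p^\alpha q^{1-\alpha}\,d\mu\in[0,\infty]$. For $\alpha\in(0,1)$, $P_\alpha$ is the probability distribution with density $p_\alpha=\dfrac{q^{1-\alpha}p^\alpha}{\int q^{1-\alpha}p^\alpha\,d\mu}$, which is well defined if and only if $0<\int p^\alpha q^{1-\alpha}\,d\mu<\infty$ (this is the case whenever $D(P\|Q)<\infty$). *)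

theory Defs
  imports "HOL-Probability.Probability"
begin

section \<open>Dominating measures and densities\<close>

definition sum_measure :: "'a measure \<Rightarrow> 'a measure \<Rightarrow> 'a measure" where
  "sum_measure P Q = measure_of (space P) (sets P) (\<lambda>A. emeasure P A + emeasure Q A)"

text \<open>
  The divergences below are computed with the canonical dominating measure \<open>P + Q\<close>.
  The lemmas \<open>KL_div_eq\<close>, \<open>hellinger_integral_eq\<close> and \<open>tilted_eq\<close> at the end show that any
  other \<open>\<sigma>\<close>-finite dominating measure, with any choice of densities, gives the same result.
\<close>

definition dens :: "'a measure \<Rightarrow> 'a measure \<Rightarrow> 'a \<Rightarrow> real" where
  "dens \<mu> P x = enn2real (RN_deriv \<mu> P x)"

section \<open>Kullback-Leibler divergence\<close>

text \<open>
  The library's \<open>KL_divergence\<close> is real-valued (a divergent integral gives 0), so it cannot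
  express infinite divergences.
\<close>

text \<open>Lebesgue integral with values in the extended reals; \<open>e2ennreal\<close> truncates negative
  values to 0, so the two terms are the integrals of the positive and the negative part. It is
  only meaningful if one of them is finite.\<close>

definition ext_integral :: "'a measure \<Rightarrow> ('a \<Rightarrow> ereal) \<Rightarrow> ereal" where
  "ext_integral \<mu> f =
     enn2ereal (\<integral>\<^sup>+x. e2ennreal (f x) \<partial>\<mu>) - enn2ereal (\<integral>\<^sup>+x. e2ennreal (- f x) \<partial>\<mu>)"

definition kl_integrand :: "real \<Rightarrow> real \<Rightarrow> ereal" where
  "kl_integrand p q =
     (if p = 0 then 0 else if q = 0 then \<infinity> else ereal (p * ln (p / q)))"

definition KL_div :: "'a measure \<Rightarrow> 'a measure \<Rightarrow> ereal" where
  "KL_div P Q = (let \<mu> = sum_measure P Q in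
     ext_integral \<mu> (\<lambda>x. kl_integrand (dens \<mu> P x) (dens \<mu> Q x)))"

section \<open>Renyi divergence of order in (0,1) and the tilted distributions\<close>

definition eln :: "ennreal \<Rightarrow> ereal" where
  "eln x = (if x = 0 then -\<infinity> else if x = \<infinity> then \<infinity> else ereal (ln (enn2real x)))"

definition hellinger_integral :: "real \<Rightarrow> 'a measure \<Rightarrow> 'a measure \<Rightarrow> ennreal" where
  "hellinger_integral \<alpha> P Q = (let \<mu> = sum_measure P Q in
     (\<integral>\<^sup>+x. ennreal (dens \<mu> P x powr \<alpha> * dens \<mu> Q x powr (1 - \<alpha>)) \<partial>\<mu>))"

definition renyi_div :: "real \<Rightarrow> 'a measure \<Rightarrow> 'a measure \<Rightarrow> ereal" where
  "renyi_div \<alpha> P Q = ereal (1 / (\<alpha> - 1)) * eln (hellinger_integral \<alpha> P Q)"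

text \<open>\<open>tilted \<alpha> P Q\<close> is the distribution \<open>P\<^sub>\<alpha>\<close>.\<close>

definition tilted :: "real \<Rightarrow> 'a measure \<Rightarrow> 'a measure \<Rightarrow> 'a measure" where
  "tilted \<alpha> P Q = (let \<mu> = sum_measure P Q in
     density \<mu> (\<lambda>x. ennreal (dens \<mu> Q x powr (1 - \<alpha>) * dens \<mu> P x powr \<alpha>)
                     / hellinger_integral \<alpha> P Q))"

section \<open>The objective function and saddle-points\<close>

text \<open>
  The first case is the convention for undefined values: for \<open>\<alpha> > 0\<close> the expression
  \<open>\<alpha> D(R\<parallel>P) + (1 - \<alpha>) D(R\<parallel>Q)\<close> can only be undefined as \<open>\<infinity> - \<infinity>\<close> (when \<open>\<alpha> > 1\<close>) or because of
  the product \<open>0 * \<infinity>\<close> (when \<open>\<alpha> = 1\<close>), for which \<open>ereal\<close> would otherwise return 0.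
\<close>

definition kl_mix :: "'a measure \<Rightarrow> 'a measure \<Rightarrow> real \<Rightarrow> 'a measure \<Rightarrow> ereal" where
  "kl_mix P Q \<alpha> R =
     (if \<alpha> > 1 \<and> KL_div R P = \<infinity> \<and> KL_div R Q = \<infinity> \<or> \<alpha> = 1 \<and> KL_div R Q = \<infinity> then \<infinity>
      else ereal \<alpha> * KL_div R P + ereal (1 - \<alpha>) * KL_div R Q)"

definition saddle_point :: "('a \<Rightarrow> 'b \<Rightarrow> 'c::order) \<Rightarrow> 'a set \<Rightarrow> 'b set \<Rightarrow> 'a \<Rightarrow> 'b \<Rightarrow> bool" where
  "saddle_point f A B a b \<longleftrightarrow>
     a \<in> A \<and> b \<in> B \<and> (\<forall>a'\<in>A. f a' b \<le> f a b) \<and> (\<forall>b'\<in>B. f a b \<le> f a b')"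

section \<open>Independence of the dominating measure\<close>

lemma space_sum_measure [simp]: "space (sum_measure P Q) = space P"
  by (simp add: sum_measure_def)

lemma sets_sum_measure [simp, measurable_cong]: "sets (sum_measure P Q) = sets P"
  by (simp add: sum_measure_def)

lemma emeasure_sum_measure:
  assumes "sets Q = sets P" "A \<in> sets P"
  shows "emeasure (sum_measure P Q) A = emeasure P A + emeasure Q A"
  unfolding sum_measure_def
proof (rule emeasure_measure_of_sigma)
  show "sigma_algebra (space P) (sets P)" ..
  show "positive (sets P) (\<lambda>A. emeasure P A + emeasure Q A)"
    by (simp add: positive_def)
  show "countably_additive (sets P) (\<lambda>A. emeasure P A + emeasure Q A)"
  proof (rule countably_additiveI)
    fix B :: "nat \<Rightarrow> 'a set"
    assume B: "range B \<subseteq> sets P" "disjoint_family B"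
    have "(\<Sum>i. emeasure P (B i) + emeasure Q (B i)) = (\<Sum>i. emeasure P (B i)) + (\<Sum>i. emeasure Q (B i))"
      by (rule suminf_add[symmetric]) auto
    then show "(\<Sum>i. emeasure P (B i) + emeasure Q (B i)) = emeasure P (\<Union> (range B)) + emeasure Q (\<Union> (range B))"
      using B assms by (simp add: suminf_emeasure)
  qed
qed (use assms in auto)

lemma borel_measurable_dens [measurable]: "dens \<mu> P \<in> borel_measurable \<mu>"
  unfolding dens_def by measurable

lemma dens_nonneg [simp]: "0 \<le> dens \<mu> P x"
  by (simp add: dens_def)

locale dominated_pair =
  fixes \<mu> P Q :: "'a measure" and p q :: "'a \<Rightarrow> real"
  assumes sf: "sigma_finite_measure \<mu>"
    and meas [measurable]: "p \<in> borel_measurable \<mu>" "q \<in> borel_measurable \<mu>"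
    and nonneg: "\<And>x. 0 \<le> p x" "\<And>x. 0 \<le> q x"
    and P: "P = density \<mu> (\<lambda>x. ennreal (p x))" and Q: "Q = density \<mu> (\<lambda>x. ennreal (q x))"
    and prob: "prob_space P" "prob_space Q"
begin

abbreviation "\<nu> \<equiv> sum_measure P Q"

lemma sets_PQ [simp, measurable_cong]: "sets P = sets \<mu>" "sets Q = sets \<mu>"
  by (auto simp: P Q)

lemma space_PQ: "space P = space \<mu>" "space Q = space \<mu>"
  by (auto simp: P Q)

lemma sum_measure_density: "\<nu> = density \<mu> (\<lambda>x. ennreal (p x + q x))"
proof (rule measure_eqI)
  fix A assume "A \<in> sets \<nu>"
  then have [measurable]: "A \<in> sets \<mu>" by simp
  have "emeasure \<nu> A = (\<integral>\<^sup>+x. ennreal (p x) * indicator A x \<partial>\<mu>) + (\<integral>\<^sup>+x. ennreal (q x) * indicator A x \<partial>\<mu>)"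
    by (subst emeasure_sum_measure) (auto simp: P Q emeasure_density)
  also have "\<dots> = (\<integral>\<^sup>+x. ennreal (p x + q x) * indicator A x \<partial>\<mu>)"
    by (subst nn_integral_add[symmetric]) (auto intro!: nn_integral_cong simp: nonneg distrib_right)
  finally show "emeasure \<nu> A = emeasure (density \<mu> (\<lambda>x. ennreal (p x + q x))) A"
    by (simp add: emeasure_density)
qed simp

lemma finite_sum_measure: "finite_measure \<nu>"
proof
  interpret P: prob_space P by (rule prob)
  interpret Q: prob_space Q by (rule prob)
  have "emeasure \<nu> (space \<nu>) = emeasure P (space P) + emeasure Q (space Q)"
    by (subst emeasure_sum_measure) (auto simp: space_PQ)
  then show "emeasure \<nu> (space \<nu>) \<noteq> \<infinity>"
    by (simp add: P.emeasure_space_1 Q.emeasure_space_1)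
qed

lemma dens_AE:
  assumes [measurable]: "f \<in> borel_measurable \<mu>" and f: "\<And>x. 0 \<le> f x"
    and N: "N = density \<mu> (\<lambda>x. ennreal (f x))" "prob_space N"
    and ac: "absolutely_continuous \<nu> N"
  shows "AE x in \<mu>. f x = (p x + q x) * dens \<nu> N x"
proof -
  interpret nu: finite_measure \<nu> by (rule finite_sum_measure)
  interpret mu: sigma_finite_measure \<mu> by (rule sf)
  interpret N: prob_space N by (rule N)
  have sN: "sets N = sets \<nu>" by (simp add: N)
  have "AE x in \<nu>. RN_deriv \<nu> N x \<noteq> \<infinity>"
    using ac sN by (intro nu.RN_deriv_finite) (auto intro: N.sigma_finite_measure_axioms)
  then have fin: "AE x in \<mu>. 0 < p x + q x \<longrightarrow> RN_deriv \<nu> N x \<noteq> \<infinity>"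
    by (subst (asm) (1) sum_measure_density, subst (asm) AE_density) auto
  have m[measurable]: "RN_deriv \<nu> N \<in> borel_measurable \<mu>"
    using borel_measurable_RN_deriv[of \<nu> N] by (simp cong: measurable_cong_sets)
  have "density \<mu> (\<lambda>x. ennreal (f x)) = density \<nu> (RN_deriv \<nu> N)"
    using nu.density_RN_deriv[OF ac sN] N by simp
  also have "\<dots> = density \<mu> (\<lambda>x. ennreal (p x + q x) * RN_deriv \<nu> N x)"
    by (subst (1) sum_measure_density, subst density_density_eq) auto
  finally have "AE x in \<mu>. ennreal (f x) = ennreal (p x + q x) * RN_deriv \<nu> N x"
    by (subst (asm) mu.density_unique_iff) auto
  then show ?thesis using fin
  proof eventually_elim
    case (elim x)
    then have "f x = enn2real (ennreal (p x + q x) * RN_deriv \<nu> N x)"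
      using f[of x] by (metis enn2real_ennreal)
    then show ?case
      using nonneg[of x] by (simp add: enn2real_mult dens_def del: ennreal_plus)
  qed
qed

lemma dens_PQ_AE:
  "AE x in \<mu>. p x = (p x + q x) * dens \<nu> P x"
  "AE x in \<mu>. q x = (p x + q x) * dens \<nu> Q x"
proof -
  have "absolutely_continuous \<nu> P" "absolutely_continuous \<nu> Q"
    unfolding absolutely_continuous_def null_sets_def by (auto simp: emeasure_sum_measure)
  then show "AE x in \<mu>. p x = (p x + q x) * dens \<nu> P x"
    "AE x in \<mu>. q x = (p x + q x) * dens \<nu> Q x"
    by (auto intro: dens_AE[OF meas(1) nonneg(1) P prob(1)] dens_AE[OF meas(2) nonneg(2) Q prob(2)])
qed

lemma nn_integral_homogeneous:
  fixes G :: "'a \<Rightarrow> real \<Rightarrow> real \<Rightarrow> ennreal"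
  assumes G: "(\<lambda>x. G x (dens \<nu> P x) (dens \<nu> Q x)) \<in> borel_measurable \<nu>"
    and hom: "\<And>x a b c. 0 \<le> a \<Longrightarrow> 0 \<le> b \<Longrightarrow> 0 \<le> c \<Longrightarrow> G x (c * a) (c * b) = ennreal c * G x a b"
  shows "(\<integral>\<^sup>+x. G x (dens \<nu> P x) (dens \<nu> Q x) \<partial>\<nu>) = (\<integral>\<^sup>+x. G x (p x) (q x) \<partial>\<mu>)"
proof -
  have G': "(\<lambda>x. G x (dens \<nu> P x) (dens \<nu> Q x)) \<in> borel_measurable \<mu>"
    using G by (simp cong: measurable_cong_sets)
  have "(\<integral>\<^sup>+x. G x (dens \<nu> P x) (dens \<nu> Q x) \<partial>\<nu>)
      = (\<integral>\<^sup>+x. G x (dens \<nu> P x) (dens \<nu> Q x) \<partial>density \<mu> (\<lambda>x. ennreal (p x + q x)))"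
    by (rule arg_cong[where f = "\<lambda>M. integral\<^sup>N M _"]) (rule sum_measure_density)
  also have "\<dots> = (\<integral>\<^sup>+x. ennreal (p x + q x) * G x (dens \<nu> P x) (dens \<nu> Q x) \<partial>\<mu>)"
    using G' by (subst nn_integral_density) auto
  also have "\<dots> = (\<integral>\<^sup>+x. G x (p x) (q x) \<partial>\<mu>)"
    using dens_PQ_AE
  proof (intro nn_integral_cong_AE, eventually_elim)
    case (elim x)
    have "ennreal (p x + q x) * G x (dens \<nu> P x) (dens \<nu> Q x)
        = G x ((p x + q x) * dens \<nu> P x) ((p x + q x) * dens \<nu> Q x)"
      by (rule hom[symmetric]) (auto simp: nonneg)
    with elim show ?case by simp
  qed
  finally show ?thesis .
qed

end

lemma borel_measurable_kl_integrand [measurable (raw)]: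
  assumes [measurable]: "f \<in> borel_measurable M" "g \<in> borel_measurable M"
  shows "(\<lambda>x. kl_integrand (f x) (g x)) \<in> borel_measurable M"
  unfolding kl_integrand_def by measurable

lemma kl_integrand_mult:
  assumes "0 \<le> c"
  shows "kl_integrand (c * a) (c * b) = ereal c * kl_integrand a b"
  using assms by (auto simp: kl_integrand_def)

lemma e2ennreal_ereal_mult:
  assumes "0 \<le> c"
  shows "e2ennreal (ereal c * y) = ennreal c * e2ennreal y"
proof (cases "0 \<le> y")
  case True
  have "enn2ereal (e2ennreal (ereal c * y)) = enn2ereal (ennreal c * e2ennreal y)"
    using True assms by (simp add: times_ennreal.rep_eq enn2ereal_e2ennreal)
  then show ?thesis by (simp only: enn2ereal_inject)
next
  case False
  then have "ereal c * y \<le> 0"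
    using assms by (cases y) (auto simp: mult_nonneg_nonpos)
  then show ?thesis using False by (simp add: e2ennreal_neg)
qed

lemma ereal_mult_uminus_right: "ereal c * - y = - (ereal c * y)"
  by (cases y) auto

context dominated_pair
begin

lemma KL_div_eq: "KL_div P Q = ext_integral \<mu> (\<lambda>x. kl_integrand (p x) (q x))"
proof -
  have pos: "e2ennreal (kl_integrand (c * a) (c * b)) = ennreal c * e2ennreal (kl_integrand a b)"
    and neg: "e2ennreal (- kl_integrand (c * a) (c * b)) = ennreal c * e2ennreal (- kl_integrand a b)"
    if "0 \<le> c" for a b c
    using that by (simp_all only: kl_integrand_mult e2ennreal_ereal_mult ereal_mult_uminus_right[symmetric])
  have "(\<integral>\<^sup>+x. e2ennreal (kl_integrand (dens \<nu> P x) (dens \<nu> Q x)) \<partial>\<nu>)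
      = (\<integral>\<^sup>+x. e2ennreal (kl_integrand (p x) (q x)) \<partial>\<mu>)"
    by (rule nn_integral_homogeneous[where G = "\<lambda>x a b. e2ennreal (kl_integrand a b)"]) (simp_all add: pos)
  moreover have "(\<integral>\<^sup>+x. e2ennreal (- kl_integrand (dens \<nu> P x) (dens \<nu> Q x)) \<partial>\<nu>)
      = (\<integral>\<^sup>+x. e2ennreal (- kl_integrand (p x) (q x)) \<partial>\<mu>)"
    by (rule nn_integral_homogeneous[where G = "\<lambda>x a b. e2ennreal (- kl_integrand a b)"]) (simp_all add: neg)
  ultimately show ?thesis
    by (simp only: KL_div_def Let_def ext_integral_def)
qed

lemma powr_homogeneous:
  "0 \<le> a \<Longrightarrow> 0 \<le> b \<Longrightarrow> 0 \<le> c \<Longrightarrow>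
    (c * a) powr \<alpha> * (c * b) powr (1 - \<alpha>) = c * (a powr \<alpha> * b powr (1 - \<alpha>))" for a b c \<alpha> :: real
proof (cases "c = 0")
  case False
  assume *: "0 \<le> a" "0 \<le> b" "0 \<le> c"
  then have "c powr \<alpha> * c powr (1 - \<alpha>) = c"
    using False by (simp flip: powr_add)
  then have "(c * a) powr \<alpha> * (c * b) powr (1 - \<alpha>) = (c powr \<alpha> * c powr (1 - \<alpha>)) * (a powr \<alpha> * b powr (1 - \<alpha>))"
    using * by (simp only: powr_mult mult_ac)
  with \<open>c powr \<alpha> * c powr (1 - \<alpha>) = c\<close> show ?thesis by simp
qed simp

lemma hellinger_integral_eq:
  "hellinger_integral \<alpha> P Q = (\<integral>\<^sup>+x. ennreal (p x powr \<alpha> * q x powr (1 - \<alpha>)) \<partial>\<mu>)"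
  unfolding hellinger_integral_def Let_def
  by (rule nn_integral_homogeneous[where G = "\<lambda>x a b. ennreal (a powr \<alpha> * b powr (1 - \<alpha>))"])
     (auto simp: powr_homogeneous ennreal_mult)

lemma tilted_eq:
  "tilted \<alpha> P Q = density \<mu> (\<lambda>x. ennreal (q x powr (1 - \<alpha>) * p x powr \<alpha>)
                     / (\<integral>\<^sup>+x. ennreal (p x powr \<alpha> * q x powr (1 - \<alpha>)) \<partial>\<mu>))"
proof (rule measure_eqI)
  show "sets (tilted \<alpha> P Q) = sets (density \<mu> (\<lambda>x. ennreal (q x powr (1 - \<alpha>) * p x powr \<alpha>)
                     / (\<integral>\<^sup>+x. ennreal (p x powr \<alpha> * q x powr (1 - \<alpha>)) \<partial>\<mu>)))"
    by (simp add: tilted_def Let_def)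
next
  fix A assume "A \<in> sets (tilted \<alpha> P Q)"
  then have [measurable]: "A \<in> sets \<mu>" "A \<in> sets \<nu>"
    by (simp_all add: tilted_def Let_def)
  let ?Z = "hellinger_integral \<alpha> P Q"
  have hom: "ennreal ((c * a) powr \<alpha> * (c * b) powr (1 - \<alpha>)) / ?Z * indicator A x
      = ennreal c * (ennreal (a powr \<alpha> * b powr (1 - \<alpha>)) / ?Z * indicator A x)"
    if "0 \<le> a" "0 \<le> b" "0 \<le> c" for a b c x
    using that by (simp only: powr_homogeneous ennreal_mult'[of c] divide_ennreal_def mult.assoc)
  have "emeasure (tilted \<alpha> P Q) A =
      (\<integral>\<^sup>+x. ennreal (dens \<nu> P x powr \<alpha> * dens \<nu> Q x powr (1 - \<alpha>)) / ?Z * indicator A x \<partial>\<nu>)"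
    by (simp add: tilted_def Let_def emeasure_density mult.commute)
  also have "\<dots> = (\<integral>\<^sup>+x. ennreal (p x powr \<alpha> * q x powr (1 - \<alpha>)) / ?Z * indicator A x \<partial>\<mu>)"
    by (rule nn_integral_homogeneous[where
        G = "\<lambda>x a b. ennreal (a powr \<alpha> * b powr (1 - \<alpha>)) / ?Z * indicator A x"])
       (simp, rule hom)
  finally show "emeasure (tilted \<alpha> P Q) A =
      emeasure (density \<mu> (\<lambda>x. ennreal (q x powr (1 - \<alpha>) * p x powr \<alpha>)
                     / (\<integral>\<^sup>+x. ennreal (p x powr \<alpha> * q x powr (1 - \<alpha>)) \<partial>\<mu>))) A"
    by (simp add: emeasure_density hellinger_integral_eq[symmetric] mult.commute)
qed

end

end

theory Submission
  imports Defs
begin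

text \<open>
  Write \<open>Z \<alpha>\<close> for the Hellinger integral and \<open>slope \<alpha>\<close> for the mean of \<open>ln (p / q)\<close> under \<open>P\<^sub>\<alpha>\<close>.
  Integrating \<open>r ln (r / p\<^sub>\<alpha>) \<ge> r - p\<^sub>\<alpha>\<close> gives \<open>\<alpha> D(R\<parallel>P) + (1 - \<alpha>) D(R\<parallel>Q) \<ge> - ln (Z \<alpha>)\<close>, with
  equality at \<open>R = P\<^sub>\<alpha>\<close>. Since \<open>D(P\<^sub>\<beta>\<parallel>Q) = \<beta> slope \<beta> - ln (Z \<beta>)\<close> and \<open>D(P\<^sub>\<beta>\<parallel>Q) - D(P\<^sub>\<beta>\<parallel>P) = slope \<beta>\<close>,
  the objective at \<open>P\<^sub>\<beta>\<close> is at most \<open>\<beta> slope \<beta> - ln (Z \<beta>)\<close> for all \<open>\<alpha> > 0\<close> as soon as \<open>slope \<beta> \<ge> 0\<close>. So it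
  suffices to find \<open>\<beta> \<in> (0,1)\<close> with \<open>slope \<beta> \<ge> 0\<close> and \<open>\<beta> slope \<beta>\<close> arbitrarily small. Take a zero of \<open>slope\<close> if
  there is one; otherwise \<open>slope\<close> has constant sign by continuity. If it is negative, \<open>ln \<circ> Z\<close> decreases
  strictly, contradicting \<open>ln (Z \<alpha>) \<le> 0\<close> and \<open>- ln (Z \<alpha>) \<le> (1 - \<alpha>) D(P\<parallel>Q)\<close>. If it is
  positive, pick \<open>\<alpha>\<close> with \<open>ln (Z \<alpha>)\<close> near its infimum; the subgradient inequality at \<open>\<beta> = \<alpha> / 2\<close>
  bounds \<open>\<beta> slope \<beta>\<close> by \<open>ln (Z \<alpha>) - ln (Z \<beta>)\<close>.
\<close>

section \<open>Pointwise inequalities for powers and logarithms\<close>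

text \<open>This is \<open>ln t \<le> t - 1\<close> at \<open>t = p / r\<close>. Integrated, it
  yields both nonnegativity of the divergence and the variational bound.\<close>

lemma diff_le_mult_ln_div:
  fixes r p :: real
  assumes "0 \<le> r" "0 \<le> p" "0 < r \<Longrightarrow> 0 < p"
  shows "r - p \<le> r * ln (r / p)"
proof (cases "r = 0")
  case False
  with assms have *: "0 < r" "0 < p" by auto
  then have "ln (p / r) \<le> p / r - 1"
    by (intro ln_le_minus_one) simp
  then have "r * ln (p / r) \<le> p - r"
    using * by (simp add: field_simps)
  with * show ?thesis
    by (simp add: ln_div algebra_simps)
qed (use assms in simp)

text \<open>Enlarging both bases to \<open>p + q\<close> makes the exponents add up to 1. The bound
  does not depend on \<alpha>, so \<open>p + q\<close> is an integrable majorant for all orders at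
  once.\<close>

lemma powr_mult_powr_le_add:
  fixes p q \<alpha> :: real
  assumes "0 \<le> p" "0 \<le> q" "0 \<le> \<alpha>" "\<alpha> \<le> 1"
  shows "p powr \<alpha> * q powr (1 - \<alpha>) \<le> p + q"
proof -
  have "p powr \<alpha> * q powr (1 - \<alpha>) \<le> (p + q) powr \<alpha> * (p + q) powr (1 - \<alpha>)"
    using assms by (intro mult_mono powr_mono2) auto
  also have "\<dots> = (p + q) powr 1"
    by (subst powr_add[symmetric]) simp
  finally show ?thesis using assms by simp
qed

text \<open>The logarithm costs only a factor \<open>(a / b) powr \<delta> / \<delta>\<close>, which
  shifts the order by \<delta> and keeps it within [0,1]. The bound is uniform over orders in
  [\<delta>, 1 - \<delta>].\<close>

lemma powr_mult_powr_abs_ln_le: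
  fixes p q \<alpha> \<delta> :: real
  assumes pq: "0 \<le> p" "0 \<le> q" and \<delta>: "0 < \<delta>" "\<delta> \<le> \<alpha>" "\<delta> \<le> 1 - \<alpha>"
  shows "p powr \<alpha> * q powr (1 - \<alpha>) * \<bar>ln (p / q)\<bar> \<le> (p + q) / \<delta>"
proof -
  \<comment> \<open>Only \<open>b \<le> a\<close> needs work: exchanging \<open>p\<close> and
    \<open>q\<close> turns \<alpha> into \<open>1 - \<alpha>\<close> and preserves the absolute
    logarithm.\<close>
  have *: "a powr \<beta> * b powr (1 - \<beta>) * \<bar>ln (a / b)\<bar> \<le> (a + b) / \<delta>"
    if ab: "0 < b" "b \<le> a" and \<beta>: "\<delta> \<le> \<beta>" "\<delta> \<le> 1 - \<beta>" for a b \<beta> :: real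
  proof -
    have "\<bar>ln (a / b)\<bar> = ln (a / b)" using ab by simp
    also have "\<dots> \<le> (a / b) powr \<delta> / \<delta>"
      using ab \<delta> by (intro ln_powr_bound) auto
    finally have "a powr \<beta> * b powr (1 - \<beta>) * \<bar>ln (a / b)\<bar>
        \<le> a powr \<beta> * b powr (1 - \<beta>) * ((a / b) powr \<delta> / \<delta>)"
      by (intro mult_left_mono) auto
    also have "\<dots> = a powr (\<beta> + \<delta>) * b powr (1 - (\<beta> + \<delta>)) / \<delta>"
      using ab by (simp add: powr_divide powr_add powr_diff field_simps)
    also have "\<dots> \<le> (a + b) / \<delta>"
      using ab \<beta> \<delta> by (intro divide_right_mono powr_mult_powr_le_add) auto
    finally show ?thesis .
  qed
  consider "p = 0 \<or> q = 0" | "0 < q" "q \<le> p" | "0 < p" "p \<le> q"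
    using pq by fastforce
  then show ?thesis
  proof cases
    case 1
    then show ?thesis using pq \<delta> by auto
  next
    case 2
    then show ?thesis using *[of q p \<alpha>] \<delta> by simp
  next
    case 3
    then have "\<bar>ln (p / q)\<bar> = \<bar>ln (q / p)\<bar>" by (simp add: ln_div abs_minus_commute)
    with 3 show ?thesis using *[of p q "1 - \<alpha>"] \<delta> by (simp add: mult_ac add.commute)
  qed
qed

text \<open>Here \<open>ln g\<close> is a convex combination of \<open>ln p\<close> and
  \<open>ln q\<close>. Where \<open>p\<close> or \<open>q\<close> vanishes, \<open>g = 0\<close>
  makes both sides zero, so no positivity of \<open>p\<close> and \<open>q\<close> is
  required.\<close>

lemma tilt_mult_ln_div:
  fixes p q \<alpha> z :: real
  defines "g \<equiv> p powr \<alpha> * q powr (1 - \<alpha>)"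
  assumes "0 \<le> p" "0 \<le> q" "0 < z"
  shows "g / z * ln (g / z / p) = (\<alpha> - 1) / z * (g * ln (p / q)) - ln z / z * g"
    and "g / z * ln (g / z / q) = \<alpha> / z * (g * ln (p / q)) - ln z / z * g"
proof -
  have "g / z * ln (g / z / p) = g / z * ((\<alpha> - 1) * ln (p / q) - ln z)
    \<and> g / z * ln (g / z / q) = g / z * (\<alpha> * ln (p / q) - ln z)"
  proof (cases "p = 0 \<or> q = 0")
    case False
    with assms have *: "0 < p" "0 < q" "0 < g" by auto
    then have "ln g = \<alpha> * ln p + (1 - \<alpha>) * ln q"
      unfolding g_def by (simp add: ln_mult ln_powr)
    then have "ln (g / z / p) = (\<alpha> - 1) * ln (p / q) - ln z"
      "ln (g / z / q) = \<alpha> * ln (p / q) - ln z"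
      using * \<open>0 < z\<close> by (simp_all add: ln_divide_pos ln_mult_pos algebra_simps)
    then show ?thesis by (simp only:)
  qed (auto simp: g_def)
  then show "g / z * ln (g / z / p) = (\<alpha> - 1) / z * (g * ln (p / q)) - ln z / z * g"
    and "g / z * ln (g / z / q) = \<alpha> / z * (g * ln (p / q)) - ln z / z * g"
    by (simp_all add: algebra_simps diff_divide_distrib)
qed

section \<open>Common dominating measures\<close>

lemma finite_measure_sum_measure:
  assumes "finite_measure P" "finite_measure Q" "sets Q = sets P"
  shows "finite_measure (sum_measure P Q)"
proof
  have "space Q = space P" using assms(3) by (rule sets_eq_imp_space_eq)
  then have "emeasure (sum_measure P Q) (space P) = emeasure P (space P) + emeasure Q (space Q)"
    using assms by (subst emeasure_sum_measure) auto
  then show "emeasure (sum_measure P Q) (space (sum_measure P Q)) \<noteq> \<infinity>"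
    using assms(1,2) by (auto simp: finite_measure.emeasure_finite)
qed

lemma absolutely_continuous_sum_measure:
  assumes "sets Q = sets P"
  shows "absolutely_continuous (sum_measure P Q) P" "absolutely_continuous (sum_measure P Q) Q"
  using assms unfolding absolutely_continuous_def null_sets_def
  by (auto simp: emeasure_sum_measure)

text \<open>The Radon-Nikodym derivative is finite almost everywhere, so \<open>enn2real\<close> in
  \<open>dens\<close> loses nothing.\<close>

lemma density_dens:
  assumes "finite_measure \<mu>" "finite_measure N" "absolutely_continuous \<mu> N" "sets N = sets \<mu>"
  shows "density \<mu> (\<lambda>x. ennreal (dens \<mu> N x)) = N"
proof -
  interpret finite_measure \<mu> by fact
  interpret N: finite_measure N by fact
  have "AE x in \<mu>. RN_deriv \<mu> N x \<noteq> \<infinity>"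
    using assms N.sigma_finite_measure_axioms by (intro RN_deriv_finite) auto
  then have "density \<mu> (\<lambda>x. ennreal (dens \<mu> N x)) = density \<mu> (RN_deriv \<mu> N)"
    by (intro density_cong) (auto simp: dens_def less_top)
  then show ?thesis using density_RN_deriv assms by simp
qed

text \<open>The measure is left general because a third distribution will have to be dominated
  together with \<open>P\<close> and \<open>Q\<close>.\<close>

lemma dominated_pairI:
  assumes "finite_measure \<mu>" "prob_space P" "prob_space Q"
    "absolutely_continuous \<mu> P" "absolutely_continuous \<mu> Q" "sets P = sets \<mu>" "sets Q = sets \<mu>"
  shows "dominated_pair \<mu> P Q (dens \<mu> P) (dens \<mu> Q)"
proof -
  interpret finite_measure \<mu> by fact
  interpret P: prob_space P by fact
  interpret Q: prob_space Q by fact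
  show ?thesis
    using assms density_dens[OF assms(1) P.finite_measure_axioms]
      density_dens[OF assms(1) Q.finite_measure_axioms] sigma_finite_measure_axioms
    by unfold_locales (auto simp: sigma_finite_countable)
qed

section \<open>Kullback-Leibler divergence as a real integral\<close>

context dominated_pair
begin

lemma integrable_pq [simp]: "integrable \<mu> p" "integrable \<mu> q"
  and integral_pq: "(\<integral>x. p x \<partial>\<mu>) = 1" "(\<integral>x. q x \<partial>\<mu>) = 1"
proof -
  have "(\<integral>\<^sup>+x. ennreal (p x) \<partial>\<mu>) = 1" "(\<integral>\<^sup>+x. ennreal (q x) \<partial>\<mu>) = 1"
    using prob_space.emeasure_space_1[OF prob(1)] prob_space.emeasure_space_1[OF prob(2)]
    by (auto simp: space_PQ emeasure_density P Q simp flip: nn_integral_set_ennreal cong: nn_integral_cong)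
  then show "integrable \<mu> p" "integrable \<mu> q" "(\<integral>x. p x \<partial>\<mu>) = 1" "(\<integral>x. q x \<partial>\<mu>) = 1"
    by (auto simp: integral_eq_nn_integral nonneg intro!: integrableI_nonneg)
qed

lemma KL_div_eq_ereal:
  assumes ac: "AE x in \<mu>. 0 < p x \<longrightarrow> 0 < q x"
    and int: "integrable \<mu> (\<lambda>x. p x * ln (p x / q x))"
  shows "KL_div P Q = ereal (\<integral>x. p x * ln (p x / q x) \<partial>\<mu>)"
proof -
  have kl: "AE x in \<mu>. kl_integrand (p x) (q x) = ereal (p x * ln (p x / q x))"
    using ac
  proof eventually_elim
    case (elim x)
    then show ?case using nonneg[of x] by (auto simp: kl_integrand_def)
  qed
  let ?f = "\<lambda>x. p x * ln (p x / q x)"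
  have "(\<integral>\<^sup>+x. e2ennreal (kl_integrand (p x) (q x)) \<partial>\<mu>) = (\<integral>\<^sup>+x. ennreal (?f x) \<partial>\<mu>)"
    "(\<integral>\<^sup>+x. e2ennreal (- kl_integrand (p x) (q x)) \<partial>\<mu>) = (\<integral>\<^sup>+x. ennreal (- ?f x) \<partial>\<mu>)"
    using kl by (auto intro!: nn_integral_cong_AE simp: e2ennreal_ereal elim!: eventually_mono)
  moreover obtain r where r: "0 \<le> r" "(\<integral>\<^sup>+x. ennreal (?f x) \<partial>\<mu>) = ennreal r"
    using int unfolding real_integrable_def by (cases "\<integral>\<^sup>+x. ennreal (?f x) \<partial>\<mu>") auto
  moreover obtain s where s: "0 \<le> s" "(\<integral>\<^sup>+x. ennreal (- ?f x) \<partial>\<mu>) = ennreal s"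
    using int unfolding real_integrable_def by (cases "\<integral>\<^sup>+x. ennreal (- ?f x) \<partial>\<mu>") auto
  moreover have "integral\<^sup>L \<mu> ?f = r - s"
    using r s by (simp add: real_lebesgue_integral_def[OF int])
  ultimately show ?thesis
    by (simp add: KL_div_eq ext_integral_def)
qed

text \<open>The negative part of the integrand is at most \<open>q\<close>, so the divergence is
  never of the form \<infinity> - \<infinity>. It is infinite or an ordinary integral.\<close>

lemma KL_div_cases:
  obtains (infinite) "KL_div P Q = \<infinity>"
  | (finite) "AE x in \<mu>. 0 < p x \<longrightarrow> 0 < q x" "integrable \<mu> (\<lambda>x. p x * ln (p x / q x))"
      "KL_div P Q = ereal (\<integral>x. p x * ln (p x / q x) \<partial>\<mu>)"
proof -
  let ?f = "\<lambda>x. p x * ln (p x / q x)"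
  have neg: "e2ennreal (- kl_integrand (p x) (q x)) \<le> ennreal (q x)" for x
  proof (cases "0 < p x \<and> 0 < q x")
    case True
    then show ?thesis
      using diff_le_mult_ln_div[of "p x" "q x"]
      by (auto simp: kl_integrand_def e2ennreal_ereal intro!: ennreal_leI)
  next
    case False
    then have "p x = 0 \<or> q x = 0" using nonneg[of x] by force
    then show ?thesis by (auto simp: kl_integrand_def e2ennreal_neg)
  qed
  have "(\<integral>\<^sup>+x. e2ennreal (- kl_integrand (p x) (q x)) \<partial>\<mu>) \<le> (\<integral>\<^sup>+x. ennreal (q x) \<partial>\<mu>)"
    by (intro nn_integral_mono neg)
  also have "\<dots> < \<infinity>"
    by (subst nn_integral_eq_integral) (auto simp: nonneg)
  finally have neg_fin: "(\<integral>\<^sup>+x. e2ennreal (- kl_integrand (p x) (q x)) \<partial>\<mu>) < \<infinity>" .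
  show ?thesis
  proof (cases "(\<integral>\<^sup>+x. e2ennreal (kl_integrand (p x) (q x)) \<partial>\<mu>) = \<infinity>")
    case True
    with neg_fin have "KL_div P Q = \<infinity>"
      unfolding KL_div_eq ext_integral_def
      by (cases "\<integral>\<^sup>+x. e2ennreal (- kl_integrand (p x) (q x)) \<partial>\<mu>") (auto simp: top_ennreal.rep_eq)
    then show ?thesis by (rule infinite)
  next
    case False
    \<comment> \<open>The integrand is infinite exactly where \<open>q x = 0 < p x\<close>, so a
      finite positive part makes that set null.\<close>
    have "AE x in \<mu>. e2ennreal (kl_integrand (p x) (q x)) \<noteq> \<infinity>"
      using False by (intro nn_integral_noteq_infinite) auto
    then have ac: "AE x in \<mu>. 0 < p x \<longrightarrow> 0 < q x"
    proof eventually_elim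
      case (elim x)
      then show ?case using nonneg(2)[of x] by (auto simp: kl_integrand_def split: if_splits)
    qed
    then have kl: "AE x in \<mu>. kl_integrand (p x) (q x) = ereal (?f x)"
    proof eventually_elim
      case (elim x)
      then show ?case using nonneg[of x] by (auto simp: kl_integrand_def)
    qed
    have "(\<integral>\<^sup>+x. e2ennreal (kl_integrand (p x) (q x)) \<partial>\<mu>) = (\<integral>\<^sup>+x. ennreal (?f x) \<partial>\<mu>)"
      "(\<integral>\<^sup>+x. e2ennreal (- kl_integrand (p x) (q x)) \<partial>\<mu>) = (\<integral>\<^sup>+x. ennreal (- ?f x) \<partial>\<mu>)"
      using kl by (auto intro!: nn_integral_cong_AE simp: e2ennreal_ereal elim!: eventually_mono)
    with False neg_fin have "integrable \<mu> ?f"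
      by (auto simp: real_integrable_def)
    with ac show ?thesis using KL_div_eq_ereal finite by blast
  qed
qed

lemma KL_div_nonneg: "0 \<le> KL_div P Q"
proof (cases rule: KL_div_cases)
  case finite
  have "(\<integral>x. p x - q x \<partial>\<mu>) \<le> (\<integral>x. p x * ln (p x / q x) \<partial>\<mu>)"
    using finite(1,2)
    by (intro integral_mono_AE) (auto elim!: eventually_mono intro: diff_le_mult_ln_div simp: nonneg)
  then show ?thesis by (simp add: finite(3) integral_pq)
qed simp

end

section \<open>The tilted family\<close>

text \<open>Finiteness serves twice: it gives absolute continuity, hence
  \<open>0 < Z \<alpha>\<close>, and it controls \<open>ln (Z \<alpha>)\<close> as \<alpha> tends to
  1.\<close>

locale finite_KL_pair = dominated_pair +
  assumes KL_finite: "KL_div P Q \<noteq> \<infinity>"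
begin

definition Z :: "real \<Rightarrow> real" where
  "Z \<alpha> = (\<integral>x. p x powr \<alpha> * q x powr (1 - \<alpha>) \<partial>\<mu>)"

text \<open>Formally the derivative of \<open>Z\<close>, by differentiation under the integral
  sign.\<close>

definition log_moment :: "real \<Rightarrow> real" where
  "log_moment \<alpha> = (\<integral>x. p x powr \<alpha> * q x powr (1 - \<alpha>) * ln (p x / q x) \<partial>\<mu>)"

definition slope :: "real \<Rightarrow> real" where
  "slope \<alpha> = log_moment \<alpha> / Z \<alpha>"

lemma AE_pos: "AE x in \<mu>. 0 < p x \<longrightarrow> 0 < q x"
  using KL_finite by (cases rule: KL_div_cases) auto

section \<open>Integrability and continuity in the order\<close>

lemma integrable_Z: "0 < \<alpha> \<Longrightarrow> \<alpha> < 1 \<Longrightarrow> integrable \<mu> (\<lambda>x. p x powr \<alpha> * q x powr (1 - \<alpha>))"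
  by (rule Bochner_Integration.integrable_bound[where f = "\<lambda>x. p x + q x"])
     (auto simp: nonneg intro!: powr_mult_powr_le_add)

lemma abs_log_moment_le:
  assumes "0 < \<delta>" "\<delta> \<le> \<alpha>" "\<delta> \<le> 1 - \<alpha>"
  shows "norm (p x powr \<alpha> * q x powr (1 - \<alpha>) * ln (p x / q x)) \<le> (p x + q x) / \<delta>"
  using powr_mult_powr_abs_ln_le[of "p x" "q x", OF _ _ assms] nonneg
  by (simp add: abs_mult)

lemma integrable_log_moment:
  assumes "0 < \<alpha>" "\<alpha> < 1"
  shows "integrable \<mu> (\<lambda>x. p x powr \<alpha> * q x powr (1 - \<alpha>) * ln (p x / q x))"
proof (rule Bochner_Integration.integrable_bound[where f = "\<lambda>x. (p x + q x) / min \<alpha> (1 - \<alpha>)"])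
  have "norm (p x powr \<alpha> * q x powr (1 - \<alpha>) * ln (p x / q x)) \<le> (p x + q x) / min \<alpha> (1 - \<alpha>)" for x
    using assms by (intro abs_log_moment_le) auto
  then show "AE x in \<mu>. norm (p x powr \<alpha> * q x powr (1 - \<alpha>) * ln (p x / q x))
      \<le> norm ((p x + q x) / min \<alpha> (1 - \<alpha>))"
    unfolding real_norm_def by (intro AE_I2 order_trans[OF _ abs_ge_self])
qed auto

lemma continuous_on_log_moment: "continuous_on {0<..<1} log_moment"
proof (rule continuous_at_imp_continuous_on, rule ballI)
  fix \<alpha> :: real assume \<alpha>: "\<alpha> \<in> {0<..<1}"
  define \<delta> where "\<delta> = min \<alpha> (1 - \<alpha>) / 2"
  have \<delta>: "0 < \<delta>" "\<delta> < \<alpha>" "\<delta> < 1 - \<alpha>"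
    using \<alpha> by (auto simp: \<delta>_def min_def)
  have "log_moment \<midarrow>\<alpha>\<rightarrow> log_moment \<alpha>"
  proof (rule tendsto_at_iff_sequentially[THEN iffD2], intro allI impI)
    fix X :: "nat \<Rightarrow> real"
    assume X: "X \<longlonglongrightarrow> \<alpha>"
    have "eventually (\<lambda>n. X n \<in> {\<delta><..<1 - \<delta>}) sequentially"
      using X by (rule topological_tendstoD) (use \<delta> in auto)
    then obtain n0 where n0: "X n \<in> {\<delta><..<1 - \<delta>}" if "n0 \<le> n" for n
      by (auto simp: eventually_sequentially)
    \<comment> \<open>The shift by \<open>n0\<close> makes the majorant valid for every index;
      \<open>LIMSEQ_offset\<close> undoes it.\<close>
    have "(\<lambda>n. log_moment (X (n + n0))) \<longlonglongrightarrow> log_moment \<alpha>"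
      unfolding log_moment_def
    proof (rule integral_dominated_convergence[where w = "\<lambda>x. (p x + q x) / \<delta>"])
      have Xn: "(\<lambda>n. X (n + n0)) \<longlonglongrightarrow> \<alpha>" using X by (rule LIMSEQ_ignore_initial_segment)
      show "AE x in \<mu>. (\<lambda>n. p x powr X (n + n0) * q x powr (1 - X (n + n0)) * ln (p x / q x))
          \<longlonglongrightarrow> p x powr \<alpha> * q x powr (1 - \<alpha>) * ln (p x / q x)"
      proof (rule AE_I2)
        fix x
        show "(\<lambda>n. p x powr X (n + n0) * q x powr (1 - X (n + n0)) * ln (p x / q x))
            \<longlonglongrightarrow> p x powr \<alpha> * q x powr (1 - \<alpha>) * ln (p x / q x)"
          by (cases "p x = 0 \<or> q x = 0") (use \<alpha> in \<open>auto intro!: tendsto_intros Xn\<close>)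
      qed
      show "AE x in \<mu>. norm (p x powr X (n + n0) * q x powr (1 - X (n + n0)) * ln (p x / q x))
          \<le> (p x + q x) / \<delta>" for n
        using n0[of "n + n0"] \<delta> by (intro AE_I2 abs_log_moment_le) auto
    qed auto
    then have "(\<lambda>n. log_moment (X n)) \<longlonglongrightarrow> log_moment \<alpha>" by (rule LIMSEQ_offset)
    then show "(log_moment \<circ> X) \<longlonglongrightarrow> log_moment \<alpha>" by (simp add: comp_def)
  qed
  then show "isCont log_moment \<alpha>" by (simp add: isCont_def)
qed

section \<open>The tilted distribution at a fixed order\<close>

context
  fixes \<alpha> :: real
  assumes \<alpha>: "0 < \<alpha>" "\<alpha> < 1"
begin

text \<open>If \<open>Z \<alpha>\<close> vanished, \<open>p\<close> and \<open>q\<close> would have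
  almost disjoint supports; with \<open>AE_pos\<close> this forces \<open>p = 0\<close> almost
  everywhere, against total mass 1.\<close>

lemma Z_pos: "0 < Z \<alpha>"
proof -
  have "0 \<le> Z \<alpha>" by (simp add: Z_def)
  moreover have "Z \<alpha> \<noteq> 0"
  proof
    assume "Z \<alpha> = 0"
    then have "AE x in \<mu>. p x powr \<alpha> * q x powr (1 - \<alpha>) = 0"
      unfolding Z_def using \<alpha> by (subst (asm) integral_nonneg_eq_0_iff_AE) (auto intro: integrable_Z)
    with AE_pos have "AE x in \<mu>. p x = 0"
    proof eventually_elim
      case (elim x)
      then show ?case using nonneg[of x] by auto
    qed
    then have "(\<integral>x. p x \<partial>\<mu>) = (\<integral>x. 0 \<partial>\<mu>)" by (intro integral_cong_AE) auto
    then show False by (simp add: integral_pq)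
  qed
  ultimately show ?thesis by simp
qed

lemma hellinger_integral_Z: "hellinger_integral \<alpha> P Q = ennreal (Z \<alpha>)"
  unfolding hellinger_integral_eq Z_def
  by (rule nn_integral_eq_integral) (auto intro: integrable_Z \<alpha>)

lemma tilted_density:
  "tilted \<alpha> P Q = density \<mu> (\<lambda>x. ennreal (p x powr \<alpha> * q x powr (1 - \<alpha>) / Z \<alpha>))"
proof -
  have "ennreal (q x powr (1 - \<alpha>) * p x powr \<alpha>) / ennreal (Z \<alpha>)
      = ennreal (p x powr \<alpha> * q x powr (1 - \<alpha>) / Z \<alpha>)" for x
    using Z_pos by (subst divide_ennreal) (simp_all add: mult.commute)
  then show ?thesis
    unfolding tilted_eq hellinger_integral_eq[symmetric] hellinger_integral_Z by presburger
qed

lemma prob_space_tilted: "prob_space (tilted \<alpha> P Q)"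
proof
  have "emeasure (tilted \<alpha> P Q) (space (tilted \<alpha> P Q))
      = (\<integral>\<^sup>+x. ennreal (p x powr \<alpha> * q x powr (1 - \<alpha>) / Z \<alpha>) \<partial>\<mu>)"
    unfolding tilted_density by (auto simp: emeasure_density intro!: nn_integral_cong)
  also have "\<dots> = ennreal (\<integral>x. p x powr \<alpha> * q x powr (1 - \<alpha>) / Z \<alpha> \<partial>\<mu>)"
    using Z_pos integrable_Z[OF \<alpha>]
    by (intro nn_integral_eq_integral integrable_divide_zero) auto
  also have "(\<integral>x. p x powr \<alpha> * q x powr (1 - \<alpha>) / Z \<alpha> \<partial>\<mu>) = 1"
    using Z_pos by (simp add: Z_def)
  finally show "emeasure (tilted \<alpha> P Q) (space (tilted \<alpha> P Q)) = 1" by simp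
qed

lemma dominated_pair_tilted:
  "dominated_pair \<mu> (tilted \<alpha> P Q) P (\<lambda>x. p x powr \<alpha> * q x powr (1 - \<alpha>) / Z \<alpha>) p"
  "dominated_pair \<mu> (tilted \<alpha> P Q) Q (\<lambda>x. p x powr \<alpha> * q x powr (1 - \<alpha>) / Z \<alpha>) q"
proof -
  have m: "(\<lambda>x. p x powr \<alpha> * q x powr (1 - \<alpha>) / Z \<alpha>) \<in> borel_measurable \<mu>" by measurable
  have n: "0 \<le> p x powr \<alpha> * q x powr (1 - \<alpha>) / Z \<alpha>" for x
    using Z_pos by simp
  show
    "dominated_pair \<mu> (tilted \<alpha> P Q) P (\<lambda>x. p x powr \<alpha> * q x powr (1 - \<alpha>) / Z \<alpha>) p"
    "dominated_pair \<mu> (tilted \<alpha> P Q) Q (\<lambda>x. p x powr \<alpha> * q x powr (1 - \<alpha>) / Z \<alpha>) q"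
    by (fact dominated_pair.intro[OF sf m meas(1) n nonneg(1) tilted_density P prob_space_tilted prob(1)]
        dominated_pair.intro[OF sf m meas(2) n nonneg(2) tilted_density Q prob_space_tilted prob(2)])+
qed

text \<open>\<open>tilt_mult_ln_div\<close> reduces both integrands to those of
  \<open>log_moment\<close> and \<open>Z\<close>. Weighting the two values by \<alpha> and
  \<open>1 - \<alpha>\<close> cancels \<open>slope \<alpha>\<close> and leaves
  \<open>- ln (Z \<alpha>)\<close>.\<close>

lemma KL_div_tilted:
  "KL_div (tilted \<alpha> P Q) P = ereal ((\<alpha> - 1) * slope \<alpha> - ln (Z \<alpha>))"
  "KL_div (tilted \<alpha> P Q) Q = ereal (\<alpha> * slope \<alpha> - ln (Z \<alpha>))"
proof -
  let ?g = "\<lambda>x. p x powr \<alpha> * q x powr (1 - \<alpha>)"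
  note int = integrable_Z[OF \<alpha>] integrable_log_moment[OF \<alpha>]
  have ac: "AE x in \<mu>. 0 < ?g x / Z \<alpha> \<longrightarrow> 0 < p x" "AE x in \<mu>. 0 < ?g x / Z \<alpha> \<longrightarrow> 0 < q x"
    using Z_pos nonneg by (auto simp: less_le)
  have eq: "(\<integral>x. c / Z \<alpha> * (?g x * ln (p x / q x)) - ln (Z \<alpha>) / Z \<alpha> * ?g x \<partial>\<mu>)
      = c * slope \<alpha> - ln (Z \<alpha>)" for c
    using Z_pos int by (simp add: slope_def flip: log_moment_def Z_def)
  have "integrable \<mu> (\<lambda>x. c / Z \<alpha> * (?g x * ln (p x / q x)) - ln (Z \<alpha>) / Z \<alpha> * ?g x)" for c
    using int by (intro Bochner_Integration.integrable_diff integrable_mult_right)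
  then show
    "KL_div (tilted \<alpha> P Q) P = ereal ((\<alpha> - 1) * slope \<alpha> - ln (Z \<alpha>))"
    "KL_div (tilted \<alpha> P Q) Q = ereal (\<alpha> * slope \<alpha> - ln (Z \<alpha>))"
    using dominated_pair.KL_div_eq_ereal[OF dominated_pair_tilted(1) ac(1)]
      dominated_pair.KL_div_eq_ereal[OF dominated_pair_tilted(2) ac(2)]
    unfolding tilt_mult_ln_div[OF nonneg Z_pos] eq by blast+
qed

text \<open>Up to the term in \<open>ln (Z \<alpha>)\<close>, the right side is the divergence of
  \<open>R\<close> from the tilted distribution. If one divergence is infinite, positive weights and
  nonnegativity of the other make the bound trivial.\<close>

lemma neg_ln_Z_le:
  assumes R: "dominated_pair \<mu> R P r p" "dominated_pair \<mu> R Q r q"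
  shows "ereal (- ln (Z \<alpha>)) \<le> ereal \<alpha> * KL_div R P + ereal (1 - \<alpha>) * KL_div R Q"
proof -
  interpret RP: dominated_pair \<mu> R P r p by fact
  interpret RQ: dominated_pair \<mu> R Q r q by fact
  show ?thesis
  proof (cases rule: RP.KL_div_cases)
    case infinite
    then show ?thesis using \<alpha> RQ.KL_div_nonneg by simp
  next
    case RP: finite
    show ?thesis
    proof (cases rule: RQ.KL_div_cases)
      case infinite
      then show ?thesis using \<alpha> RP.KL_div_nonneg by simp
    next
      case RQ: finite
      let ?g = "\<lambda>x. p x powr \<alpha> * q x powr (1 - \<alpha>) / Z \<alpha>"
      \<comment> \<open>Both \<open>r\<close> and \<open>?g\<close> have mass 1, so the left side
        integrates to \<open>- ln (Z \<alpha>)\<close>.\<close>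
      have "(\<integral>x. r x - ?g x - ln (Z \<alpha>) * r x \<partial>\<mu>)
          \<le> (\<integral>x. \<alpha> * (r x * ln (r x / p x)) + (1 - \<alpha>) * (r x * ln (r x / q x)) \<partial>\<mu>)"
      proof (rule integral_mono_AE)
        show "AE x in \<mu>. r x - ?g x - ln (Z \<alpha>) * r x
            \<le> \<alpha> * (r x * ln (r x / p x)) + (1 - \<alpha>) * (r x * ln (r x / q x))"
          using RP(1) RQ(1)
        proof eventually_elim
          case (elim x)
          show ?case
          proof (cases "r x = 0")
            case True
            then show ?thesis using Z_pos by simp
          next
            case False
            then have *: "0 < r x" "0 < p x" "0 < q x"
              using elim RP.nonneg[of x] by auto
            have "r x - ?g x \<le> r x * ln (r x / ?g x)"
              using * Z_pos by (intro diff_le_mult_ln_div) auto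
            also have "ln (r x / ?g x) = \<alpha> * ln (r x / p x) + (1 - \<alpha>) * ln (r x / q x) + ln (Z \<alpha>)"
            proof -
              have "ln (p x powr \<alpha> * q x powr (1 - \<alpha>)) = \<alpha> * ln (p x) + (1 - \<alpha>) * ln (q x)"
                using * by (simp add: ln_mult ln_powr)
              moreover have "0 < p x powr \<alpha> * q x powr (1 - \<alpha>)" using * by simp
              ultimately show ?thesis using * Z_pos by (simp add: ln_divide_pos ln_mult_pos algebra_simps)
            qed
            finally show ?thesis by (simp add: algebra_simps)
          qed
        qed
      qed (use RP RQ integrable_Z[OF \<alpha>] in
        \<open>auto intro!: Bochner_Integration.integrable_diff integrable_divide_zero\<close>)
      also have "\<dots> = \<alpha> * (\<integral>x. r x * ln (r x / p x) \<partial>\<mu>) + (1 - \<alpha>) * (\<integral>x. r x * ln (r x / q x) \<partial>\<mu>)"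
        using RP RQ by simp
      also have "(\<integral>x. r x - ?g x - ln (Z \<alpha>) * r x \<partial>\<mu>) = - ln (Z \<alpha>)"
        using Z_pos integrable_Z[OF \<alpha>] by (simp add: RP.integral_pq Z_def[symmetric])
      finally show ?thesis by (simp add: RP(3) RQ(3))
    qed
  qed
qed

end

section \<open>Bounds on \<open>ln (Z \<alpha>)\<close> and the choice of an order\<close>

text \<open>The variational bound at \<open>R = P\<close>, where
  \<open>KL_div P P = 0\<close>.\<close>

lemma neg_ln_Z_le_KL_div:
  assumes "0 < \<alpha>" "\<alpha> < 1"
  shows "- ln (Z \<alpha>) \<le> (1 - \<alpha>) * real_of_ereal (KL_div P Q)"
proof -
  interpret PP: dominated_pair \<mu> P P p p
    by (rule dominated_pair.intro[OF sf meas(1) meas(1) nonneg(1) nonneg(1) P P prob(1) prob(1)])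
  have "(\<lambda>x. p x * ln (p x / p x)) = (\<lambda>x. 0)" by (auto simp: fun_eq_iff)
  then have "KL_div P P = 0"
    by (subst PP.KL_div_eq_ereal) (simp_all only: AE_I2 integrable_zero integral_zero zero_ereal_def simp_thms)
  then show ?thesis
    using neg_ln_Z_le[OF assms PP.dominated_pair_axioms dominated_pair_axioms] KL_finite KL_div_nonneg
    by (cases "KL_div P Q") auto
qed

text \<open>The slope-cancelling combination of the two divergences of the tilted distribution is
  \<open>- ln (Z \<alpha>)\<close>, and both are nonnegative.\<close>

lemma ln_Z_nonpos:
  assumes "0 < \<alpha>" "\<alpha> < 1"
  shows "ln (Z \<alpha>) \<le> 0"
proof -
  have "0 \<le> (\<alpha> - 1) * slope \<alpha> - ln (Z \<alpha>)" "0 \<le> \<alpha> * slope \<alpha> - ln (Z \<alpha>)"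
    using dominated_pair.KL_div_nonneg[OF dominated_pair_tilted(1)[OF assms]]
      dominated_pair.KL_div_nonneg[OF dominated_pair_tilted(2)[OF assms]]
    by (simp_all add: KL_div_tilted[OF assms])
  then have "0 \<le> \<alpha> * ((\<alpha> - 1) * slope \<alpha> - ln (Z \<alpha>))
      + (1 - \<alpha>) * (\<alpha> * slope \<alpha> - ln (Z \<alpha>))"
    using assms by (intro add_nonneg_nonneg mult_nonneg_nonneg) auto
  then show ?thesis by (simp add: algebra_simps)
qed

text \<open>\<open>slope \<beta>\<close> is the derivative of \<open>ln \<circ> Z\<close>; the variational inequality at
  \<open>R = P\<^sub>\<beta>\<close> already says that it is a subgradient, so no differentiation is needed.\<close>

lemma ln_Z_subgradient:
  assumes \<alpha>: "0 < \<alpha>" "\<alpha> < 1" and \<beta>: "0 < \<beta>" "\<beta> < 1"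
  shows "ln (Z \<beta>) + (\<alpha> - \<beta>) * slope \<beta> \<le> ln (Z \<alpha>)"
  using neg_ln_Z_le[OF \<alpha> dominated_pair_tilted[OF \<beta>]]
  by (simp add: KL_div_tilted[OF \<beta>] algebra_simps)

lemma near_optimal_order:
  assumes "0 < e"
  obtains \<beta> where "0 < \<beta>" "\<beta> < 1" "0 \<le> slope \<beta>" "\<beta> * slope \<beta> \<le> e"
proof -
  have "\<exists>\<beta>. 0 < \<beta> \<and> \<beta> < 1 \<and> 0 \<le> slope \<beta> \<and> \<beta> * slope \<beta> \<le> e"
  proof (rule ccontr)
    assume *: "\<not> ?thesis"
    \<comment> \<open>A zero of \<open>log_moment\<close> would itself be a witness, with product
      0.\<close>
    then have nz: "log_moment \<beta> \<noteq> 0" if "\<beta> \<in> {0<..<1}" for \<beta>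
      using that assms by (auto simp: slope_def dest!: spec[of _ \<beta>])
    have "connected (log_moment ` {0<..<1})"
      by (intro connected_continuous_image continuous_on_log_moment) simp
    \<comment> \<open>The image is an interval that misses 0.\<close>
    then have sgn: "0 < log_moment \<alpha> \<longleftrightarrow> 0 < log_moment \<beta>"
      if "\<alpha> \<in> {0<..<1}" "\<beta> \<in> {0<..<1}" for \<alpha> \<beta>
      using that nz connectedD_interval[of "log_moment ` {0<..<1}" "log_moment \<alpha>" "log_moment \<beta>" 0]
        connectedD_interval[of "log_moment ` {0<..<1}" "log_moment \<beta>" "log_moment \<alpha>" 0]
      by (force simp: not_less)
    show False
    proof (cases "0 < log_moment (1/2)")
      case True
      then have pos: "0 < log_moment \<beta>" if "\<beta> \<in> {0<..<1}" for \<beta>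
        using that sgn[of "1/2" \<beta>] by auto
      define I where "I = (INF \<alpha>\<in>{0<..<1}. ln (Z \<alpha>))"
      have bdd: "bdd_below ((\<lambda>\<alpha>. ln (Z \<alpha>)) ` {0<..<1})"
      proof (rule bdd_belowI2)
        fix \<alpha> :: real assume \<alpha>: "\<alpha> \<in> {0<..<1}"
        have "(1 - \<alpha>) * real_of_ereal (KL_div P Q) \<le> real_of_ereal (KL_div P Q)"
          using \<alpha> KL_div_nonneg by (intro mult_left_le_one_le) (auto intro: real_of_ereal_pos)
        then show "- real_of_ereal (KL_div P Q) \<le> ln (Z \<alpha>)"
          using neg_ln_Z_le_KL_div[of \<alpha>] \<alpha> by simp
      qed
      have "I < I + e" using assms by simp
      then obtain \<alpha> where \<alpha>: "\<alpha> \<in> {0<..<1}" "ln (Z \<alpha>) < I + e"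
        unfolding I_def using bdd by (subst (asm) (1) cINF_less_iff) auto
      \<comment> \<open>With \<beta> = \<alpha> / 2 the step from \<beta> to \<alpha> has length
        \<beta>, so the subgradient increment is exactly \<open>\<beta> * slope \<beta>\<close>; it
        is below \<open>e\<close> because \<open>ln (Z \<alpha>) < I + e\<close>.\<close>
      have "I \<le> ln (Z (\<alpha> / 2))"
        unfolding I_def using \<alpha> by (intro cINF_lower bdd) auto
      then have "\<alpha> / 2 * slope (\<alpha> / 2) \<le> e"
        using ln_Z_subgradient[of \<alpha> "\<alpha> / 2"] \<alpha> by simp
      moreover have "0 < slope (\<alpha> / 2)"
        unfolding slope_def using \<alpha> by (intro divide_pos_pos pos Z_pos) auto
      ultimately show False using * \<alpha> by (auto dest!: spec[of _ "\<alpha> / 2"])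
    next
      case False
      then have neg: "slope \<beta> < 0" if "\<beta> \<in> {0<..<1}" for \<beta>
        using that sgn[of "1/2" \<beta>] nz[of \<beta>] Z_pos[of \<beta>] by (auto simp: slope_def divide_less_0_iff)
      have decr: "ln (Z \<beta>) < ln (Z \<alpha>)" if "0 < \<alpha>" "\<alpha> < \<beta>" "\<beta> < 1" for \<alpha> \<beta>
      proof -
        have "0 < (\<alpha> - \<beta>) * slope \<beta>"
          using that neg[of \<beta>] by (intro mult_neg_neg) auto
        then show ?thesis using ln_Z_subgradient[of \<alpha> \<beta>] that by simp
      qed
      \<comment> \<open>By monotonicity \<open>- ln (Z (3/4))\<close> is below
        \<open>(1 - \<beta>)\<close> times the divergence for \<beta> near 1, hence at most 0. A
        second point, 1/2, turns this weak inequality into a strict one that contradicts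
        \<open>ln_Z_nonpos\<close>.\<close>
      have "- ln (Z (3/4)) \<le> 0"
      proof (rule tendsto_lowerbound)
        show "((\<lambda>\<beta>. (1 - \<beta>) * real_of_ereal (KL_div P Q)) \<longlongrightarrow> 0) (at_left 1)"
          by (rule tendsto_eq_intros | simp)+
        have "eventually (\<lambda>\<beta>. \<beta> \<in> {3/4<..<1::real}) (at_left 1)"
          by (rule eventually_at_leftI[of "3/4"]) auto
        then show "eventually (\<lambda>\<beta>. - ln (Z (3/4)) \<le> (1 - \<beta>) * real_of_ereal (KL_div P Q)) (at_left 1)"
        proof eventually_elim
          case (elim \<beta>)
          then show ?case using decr[of "3/4" \<beta>] neg_ln_Z_le_KL_div[of \<beta>] by simp
        qed
      qed simp
      then show False using decr[of "1/2" "3/4"] ln_Z_nonpos[of "1/2"] by simp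
    qed
  qed
  then show ?thesis using that by blast
qed

end

section \<open>The minimax identity\<close>

text \<open>For finite divergences the objective is \<open>b + \<alpha> * (a - b)\<close>,
  nonincreasing in \<alpha>, also beyond 1.\<close>

lemma kl_mix_le_KL_div:
  assumes "KL_div R P = ereal a" "KL_div R Q = ereal b" "a \<le> b" "0 < \<alpha>"
  shows "kl_mix P Q \<alpha> R \<le> ereal b"
proof -
  have "\<alpha> * a \<le> \<alpha> * b" using assms by simp
  then show ?thesis using assms by (simp add: kl_mix_def algebra_simps)
qed

text \<open>\<open>R\<close> may have mass outside the support of \<open>P + Q\<close>, so
  \<open>P + Q + R\<close> is taken as dominating measure. Since \<open>Z\<close> depends on that
  choice by definition, the bound is stated through \<open>hellinger_integral\<close>.\<close>

lemma neg_ln_hellinger_le_kl_mix: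
  assumes prob: "prob_space P" "prob_space Q" "prob_space R"
    and sets: "sets Q = sets P" "sets R = sets P"
    and fin: "KL_div P Q \<noteq> \<infinity>" and \<alpha>: "0 < \<alpha>" "\<alpha> < 1"
  shows "ereal (- ln (enn2real (hellinger_integral \<alpha> P Q))) \<le> kl_mix P Q \<alpha> R"
proof -
  define \<mu> where "\<mu> = sum_measure (sum_measure P Q) R"
  have \<mu>: "finite_measure \<mu>" "sets \<mu> = sets P" "absolutely_continuous \<mu> R"
    using prob[THEN prob_space.finite_measure] sets unfolding \<mu>_def
    by (simp_all add: finite_measure_sum_measure absolutely_continuous_sum_measure)
  have "null_sets \<mu> \<subseteq> null_sets (sum_measure P Q)"
    using absolutely_continuous_sum_measure(1)[of R "sum_measure P Q"] sets
    by (simp add: \<mu>_def absolutely_continuous_def)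
  then have ac: "absolutely_continuous \<mu> P" "absolutely_continuous \<mu> Q"
    using absolutely_continuous_sum_measure[OF sets(1)]
    unfolding absolutely_continuous_def by blast+
  have dom: "dominated_pair \<mu> A B (dens \<mu> A) (dens \<mu> B)" if "A \<in> {P, Q, R}" "B \<in> {P, Q, R}" for A B
    using that prob sets \<mu> ac by (intro dominated_pairI) (elim insertE emptyE; simp)+
  interpret finite_KL_pair \<mu> P Q "dens \<mu> P" "dens \<mu> Q"
    by (rule finite_KL_pair.intro[OF dom finite_KL_pair_axioms.intro[OF fin]]) simp_all
  have "ereal (- ln (Z \<alpha>)) \<le> ereal \<alpha> * KL_div R P + ereal (1 - \<alpha>) * KL_div R Q"
    by (rule neg_ln_Z_le[OF \<alpha> dom dom]) simp_all
  then show ?thesis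
    using \<alpha> Z_pos[OF \<alpha>] by (simp add: kl_mix_def hellinger_integral_Z[OF \<alpha>])
qed

theorem theorem32:
  fixes M P Q :: "'a measure"
  assumes "P \<in> space (prob_algebra M)" and "Q \<in> space (prob_algebra M)"
    and "KL_div P Q < \<infinity>"
  shows "(SUP \<alpha>\<in>{0<..}. INF R\<in>space (prob_algebra M). kl_mix P Q \<alpha> R)
           = (INF R\<in>space (prob_algebra M). SUP \<alpha>\<in>{0<..}. kl_mix P Q \<alpha> R)
    \<and> (SUP \<alpha>\<in>{0<..<1}. INF R\<in>space (prob_algebra M). kl_mix P Q \<alpha> R)
           = (INF R\<in>space (prob_algebra M). SUP \<alpha>\<in>{0<..}. kl_mix P Q \<alpha> R)
    \<and> (\<forall>\<alpha>'\<in>{0<..<1}. KL_div (tilted \<alpha>' P Q) P = KL_div (tilted \<alpha>' P Q) Q \<longrightarrow>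
           saddle_point (kl_mix P Q) {0<..} (space (prob_algebra M)) \<alpha>' (tilted \<alpha>' P Q)
         \<and> (SUP \<alpha>\<in>{0<..}. INF R\<in>space (prob_algebra M). kl_mix P Q \<alpha> R)
             = ereal (1 - \<alpha>') * renyi_div \<alpha>' P Q
         \<and> (INF R\<in>space (prob_algebra M). SUP \<alpha>\<in>{0<..}. kl_mix P Q \<alpha> R)
             = ereal (1 - \<alpha>') * renyi_div \<alpha>' P Q
         \<and> ereal (1 - \<alpha>') * renyi_div \<alpha>' P Q
             = (SUP \<alpha>\<in>{0<..<1}. ereal (1 - \<alpha>) * renyi_div \<alpha> P Q)
         \<and> (SUP \<alpha>\<in>{0<..<1}. ereal (1 - \<alpha>) * renyi_div \<alpha> P Q) = KL_div (tilted \<alpha>' P Q) P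
         \<and> KL_div (tilted \<alpha>' P Q) P = KL_div (tilted \<alpha>' P Q) Q)"
proof -
  let ?A = "space (prob_algebra M)" and ?f = "kl_mix P Q"
  let ?U = "SUP \<alpha>\<in>{0<..}. INF R\<in>?A. ?f \<alpha> R" and ?V = "INF R\<in>?A. SUP \<alpha>\<in>{0<..}. ?f \<alpha> R"
    and ?W = "SUP \<alpha>\<in>{0<..<1}. INF R\<in>?A. ?f \<alpha> R"
  define \<mu> where "\<mu> = sum_measure P Q"
  have PQ: "prob_space P" "prob_space Q" "sets P = sets M" "sets Q = sets M"
    using assms by (auto simp: space_prob_algebra)
  interpret finite_KL_pair \<mu> P Q "dens \<mu> P" "dens \<mu> Q"
    using PQ assms(3) unfolding \<mu>_def
    by (intro finite_KL_pair.intro dominated_pairI finite_measure_sum_measure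
        absolutely_continuous_sum_measure)
       (auto intro: prob_space.finite_measure simp: finite_KL_pair_axioms_def)

  have tilted_in: "tilted \<alpha> P Q \<in> ?A" if "0 < \<alpha>" "\<alpha> < 1" for \<alpha>
    using prob_space_tilted[OF that] PQ by (simp add: space_prob_algebra tilted_density[OF that])
  have lower: "ereal (- ln (Z \<alpha>)) \<le> ?f \<alpha> R" if "0 < \<alpha>" "\<alpha> < 1" "R \<in> ?A" for \<alpha> R
    using neg_ln_hellinger_le_kl_mix[of P Q R \<alpha>] that PQ Z_pos[OF that(1,2)] assms(3)
    by (simp add: space_prob_algebra hellinger_integral_Z)
  have at_tilted: "?f \<alpha> (tilted \<alpha> P Q) = ereal (- ln (Z \<alpha>))" if "0 < \<alpha>" "\<alpha> < 1" for \<alpha>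
    using that by (simp add: kl_mix_def KL_div_tilted algebra_simps)
  have INF_eq: "(INF R\<in>?A. ?f \<alpha> R) = ereal (- ln (Z \<alpha>))" if "0 < \<alpha>" "\<alpha> < 1" for \<alpha>
    using that at_tilted lower tilted_in
    by (intro antisym INF_greatest INF_lower2[of "tilted \<alpha> P Q"]) auto
  have renyi: "ereal (1 - \<alpha>) * renyi_div \<alpha> P Q = ereal (- ln (Z \<alpha>))" if "0 < \<alpha>" "\<alpha> < 1" for \<alpha>
    using that Z_pos[OF that]
    by (simp add: renyi_div_def hellinger_integral_Z eln_def field_simps)
  have W: "?W = (SUP \<alpha>\<in>{0<..<1}. ereal (- ln (Z \<alpha>)))"
    by (intro SUP_cong refl INF_eq) auto

  \<comment> \<open>Fewer orders give \<open>?W \<le> ?U\<close> and weak duality gives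
    \<open>?U \<le> ?V\<close>; only \<open>?V \<le> ?W\<close> needs a good choice of
    \<open>R\<close>.\<close>
  have "?W \<le> ?U" by (rule SUP_subset_mono) auto
  moreover have "?U \<le> ?V"
    by (intro SUP_least INF_greatest) (meson INF_lower SUP_upper order_trans)
  moreover have "?V \<le> ?W"
  proof (rule ereal_le_epsilon2)
    fix e :: real assume "0 < e"
    then obtain \<beta> where \<beta>: "0 < \<beta>" "\<beta> < 1" "0 \<le> slope \<beta>" "\<beta> * slope \<beta> \<le> e"
      by (rule near_optimal_order)
    have "?V \<le> (SUP \<alpha>\<in>{0<..}. ?f \<alpha> (tilted \<beta> P Q))"
      using tilted_in \<beta> by (intro INF_lower) auto
    \<comment> \<open>Nonnegative slope means that the tilted distribution is no farther from
      \<open>P\<close> than from \<open>Q\<close>, so its divergence from \<open>Q\<close> bounds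
      the objective at every order.\<close>
    also have "\<dots> \<le> ereal (\<beta> * slope \<beta> - ln (Z \<beta>))"
      using \<beta> by (intro SUP_least kl_mix_le_KL_div[OF KL_div_tilted]) (auto simp: algebra_simps)
    also have "\<dots> \<le> ereal (- ln (Z \<beta>)) + ereal e"
      using \<beta> by simp
    also have "\<dots> \<le> ?W + ereal e"
      unfolding W using \<beta> by (intro add_right_mono SUP_upper) auto
    finally show "?V \<le> ?W + ereal e" .
  qed
  ultimately have minimax: "?U = ?V" "?W = ?V" by auto

  have saddle: "saddle_point ?f {0<..} ?A \<alpha> (tilted \<alpha> P Q)" "?V = ereal (- ln (Z \<alpha>))"
    "KL_div (tilted \<alpha> P Q) P = ereal (- ln (Z \<alpha>))"
    if \<alpha>: "0 < \<alpha>" "\<alpha> < 1" and eq: "KL_div (tilted \<alpha> P Q) P = KL_div (tilted \<alpha> P Q) Q" for \<alpha>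
  proof -
    \<comment> \<open>The two divergences differ by exactly \<open>slope \<alpha>\<close>.\<close>
    have "slope \<alpha> = 0"
      using eq by (simp add: KL_div_tilted[OF \<alpha>] algebra_simps)
    then have KL: "KL_div (tilted \<alpha> P Q) P = ereal (- ln (Z \<alpha>))"
      "KL_div (tilted \<alpha> P Q) Q = ereal (- ln (Z \<alpha>))"
      by (simp_all add: KL_div_tilted[OF \<alpha>])
    note upper = kl_mix_le_KL_div[OF KL order_refl]
    show "saddle_point ?f {0<..} ?A \<alpha> (tilted \<alpha> P Q)"
      using \<alpha> tilted_in[OF \<alpha>] upper lower[OF \<alpha>] by (simp add: saddle_point_def at_tilted[OF \<alpha>])
    have "?V \<le> (SUP \<beta>\<in>{0<..}. ?f \<beta> (tilted \<alpha> P Q))"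
      using tilted_in \<alpha> by (intro INF_lower) auto
    also have "\<dots> \<le> ereal (- ln (Z \<alpha>))"
      by (intro SUP_least upper) auto
    \<comment> \<open>For the converse, \<open>- ln (Z \<alpha>)\<close> is one of the values in the
      supremum \<open>?W\<close>, which equals \<open>?V\<close>.\<close>
    finally show "?V = ereal (- ln (Z \<alpha>))"
      unfolding minimax(2)[symmetric] W using \<alpha> by (intro antisym SUP_upper) auto
    show "KL_div (tilted \<alpha> P Q) P = ereal (- ln (Z \<alpha>))" by (fact KL(1))
  qed
  have R: "(SUP \<alpha>\<in>{0<..<1}. ereal (1 - \<alpha>) * renyi_div \<alpha> P Q) = ?V"
    unfolding minimax(2)[symmetric] W by (intro SUP_cong refl renyi) auto
  show ?thesis
  proof (intro conjI ballI impI minimax)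
    fix \<alpha> :: real
    assume \<alpha>: "\<alpha> \<in> {0<..<1}" and eq: "KL_div (tilted \<alpha> P Q) P = KL_div (tilted \<alpha> P Q) Q"
    from \<alpha> have \<alpha>': "0 < \<alpha>" "\<alpha> < 1" by auto
    note saddle = saddle[OF \<alpha>' eq]
    show "saddle_point ?f {0<..} ?A \<alpha> (tilted \<alpha> P Q)" by (fact saddle(1))
    show "?V = ereal (1 - \<alpha>) * renyi_div \<alpha> P Q" "?U = ereal (1 - \<alpha>) * renyi_div \<alpha> P Q"
      by (simp_all only: minimax(1) saddle(2) renyi[OF \<alpha>'])
    show "ereal (1 - \<alpha>) * renyi_div \<alpha> P Q
        = (SUP \<alpha>\<in>{0<..<1}. ereal (1 - \<alpha>) * renyi_div \<alpha> P Q)"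
      by (simp only: R saddle(2) renyi[OF \<alpha>'])
    show "(SUP \<alpha>\<in>{0<..<1}. ereal (1 - \<alpha>) * renyi_div \<alpha> P Q) = KL_div (tilted \<alpha> P Q) P"
      by (simp only: R saddle(2,3))
    show "KL_div (tilted \<alpha> P Q) P = KL_div (tilted \<alpha> P Q) Q" by (fact eq)
  qed
qed

end
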